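(* Let $(\Omega,\mathcal{F},\tau)$ be a PM-space and let $\Sigma=P(\Omega)$ be the power set of $\Omega$. The restriction of the set function $\Lambda^{\mathcal{H}}:\Sigma\to\Delta^+$ to the algebra $\mathbb{S}_\tau$ of all $\Lambda^{\mathcal{H}}$-measurable sets w.r.t. $\tau$ is a $\tau$-decomposable measure.
   Context: $\Delta^+$ is the set of distance distribution functions: all $F:[-\infty,+\infty]\to[0,1]$ that are non-decreasing, left-continuous on $\mathbb{R}$, with $F(-\infty)=0$, $F(0)=0$ and $F(+\infty)=1$ (so an element is determined by its values on $]0,+\infty[$). It is ordered pointwise. The element $\varepsilon_0\in\Delta^+$ is given by $\varepsilon_0(x)=1$ for $x>0$ and $\varepsilon_0(x)=0$ otherwise. A triangle function is a mapping $\tau:\Delta^+\times\Delta^+\to\Delta^+$ that is symmetric, associative, non-decreasing in each variable, and has $\varepsilon_0$ as identity. A probabilistic metric space (PM-space) $(\Omega,\mathcal{F},\tau)$ is a non-empty set $\Omega$ with a triangle function $\tau$ and a family $\mathcal{F}$ of functions $H_{p,q}\in\Delta^+$ ($p,q\in\Omega$) such that for all $p,q,r\in\Omega$: $H_{p,q}=\varepsilon_0$ iff $p=q$; $H_{p,q}=H_{q,p}$; $H_{p,r}\geq\tau(H_{p,q},H_{q,r})$. The probabilistic Hausdorff distance between $E,F\subseteq\Omega$ is $\mathcal{H}_{E,F}(0)=0$ and, for $t\in]0,+\infty[$, $$\mathcal{H}_{E,F}(t)=\sup_{s<t}\min\Bigl\{\inf_{p\in E}\sup_{q\in F}H_{p,q}(s),\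 \inf_{q\in F}\sup_{p\in E}H_{p,q}(s)\Bigr\},$$ where, in $[0,1]$, a supremum over the empty set is $0$ and an infimum over the empty set is $1$; it is regarded as an element of $\Delta^+$ by setting it $0$ on negative arguments and $1$ at $+\infty$. Define $\Lambda^{\mathcal{H}}:\Sigma\to\Delta^+$ by $\Lambda^{\mathcal{H}}_E:=\mathcal{H}_{E^c,\Omega}$, where $E^c=\Omega\setminus E$. A set $E\in\Sigma$ is $\Lambda^{\mathcal{H}}$-measurable w.r.t. $\tau$ if $\Lambda^{\mathcal{H}}_G=\tau(\Lambda^{\mathcal{H}}_{G\cap E},\Lambda^{\mathcal{H}}_{G\cap E^c})$ for every $G\in\Sigma$; $\mathbb{S}_\tau$ is the class of all such $E$ (it is an algebra of subsets of $\Omega$). A mapping $\gamma$ from a ring of sets $\mathcal{R}$ to $\Delta^+$ is a $\tau$-decomposable measure if $\gamma_\emptyset=\varepsilon_0$ and $\gamma_{E\cup F}=\tau(\gamma_E,\gamma_F)$ for all disjoint $E,F\in\mathcal{R}$. *)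

theory Defs
  imports "HOL-Analysis.Analysis"
begin

definition Delta_plus :: "(ereal \<Rightarrow> real) set" where
  "Delta_plus = {F. range F \<subseteq> {0..1} \<and> mono F
     \<and> (\<forall>x::real. continuous (at_left x) (\<lambda>y. F (ereal y)))
     \<and> F (-\<infinity>) = 0 \<and> F 0 = 0 \<and> F \<infinity> = 1}"

definition eps0 :: "ereal \<Rightarrow> real" where
  "eps0 x = (if x > 0 then 1 else 0)"

text \<open>The order on distance distribution functions is the pointwise order of the
  function type.\<close>

locale triangle_function =
  fixes \<tau> :: "(ereal \<Rightarrow> real) \<Rightarrow> (ereal \<Rightarrow> real) \<Rightarrow> (ereal \<Rightarrow> real)"
  assumes closed: "\<lbrakk>F \<in> Delta_plus; G \<in> Delta_plus\<rbrakk> \<Longrightarrow> \<tau> F G \<in> Delta_plus"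
    and sym: "\<lbrakk>F \<in> Delta_plus; G \<in> Delta_plus\<rbrakk> \<Longrightarrow> \<tau> F G = \<tau> G F"
    and assoc: "\<lbrakk>F \<in> Delta_plus; G \<in> Delta_plus; K \<in> Delta_plus\<rbrakk>
      \<Longrightarrow> \<tau> (\<tau> F G) K = \<tau> F (\<tau> G K)"
    and mono_left: "\<lbrakk>F \<in> Delta_plus; F' \<in> Delta_plus; G \<in> Delta_plus; F \<le> F'\<rbrakk>
      \<Longrightarrow> \<tau> F G \<le> \<tau> F' G"
    and mono_right: "\<lbrakk>F \<in> Delta_plus; G \<in> Delta_plus; G' \<in> Delta_plus; G \<le> G'\<rbrakk>
      \<Longrightarrow> \<tau> F G \<le> \<tau> F G'"
    and ident: "F \<in> Delta_plus \<Longrightarrow> \<tau> F eps0 = F"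

locale PM_space = triangle_function \<tau>
  for \<tau> :: "(ereal \<Rightarrow> real) \<Rightarrow> (ereal \<Rightarrow> real) \<Rightarrow> (ereal \<Rightarrow> real)" +
  fixes \<Omega> :: "'a set" and H :: "'a \<Rightarrow> 'a \<Rightarrow> ereal \<Rightarrow> real"
  assumes nonempty: "\<Omega> \<noteq> {}"
    and in_Delta_plus: "\<lbrakk>p \<in> \<Omega>; q \<in> \<Omega>\<rbrakk> \<Longrightarrow> H p q \<in> Delta_plus"
    and eq_eps0_iff: "\<lbrakk>p \<in> \<Omega>; q \<in> \<Omega>\<rbrakk> \<Longrightarrow> H p q = eps0 \<longleftrightarrow> p = q"
    and commute: "\<lbrakk>p \<in> \<Omega>; q \<in> \<Omega>\<rbrakk> \<Longrightarrow> H p q = H q p"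
    and triangle: "\<lbrakk>p \<in> \<Omega>; q \<in> \<Omega>; r \<in> \<Omega>\<rbrakk> \<Longrightarrow> H p r \<ge> \<tau> (H p q) (H q r)"

text \<open>Supremum and infimum in the complete lattice $[0,1]$: on the reals, \<^const>\<open>Sup\<close> and
  \<^const>\<open>Inf\<close> of the empty set are unspecified.\<close>

definition Sup01 :: "real set \<Rightarrow> real" where
  "Sup01 A = (if A = {} then 0 else Sup A)"

definition Inf01 :: "real set \<Rightarrow> real" where
  "Inf01 A = (if A = {} then 1 else Inf A)"

definition prob_Hausdorff ::
    "('a \<Rightarrow> 'a \<Rightarrow> ereal \<Rightarrow> real) \<Rightarrow> 'a set \<Rightarrow> 'a set \<Rightarrow> ereal \<Rightarrow> real" where
  "prob_Hausdorff H E F t =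
     (if t \<le> 0 then 0 else if t = \<infinity> then 1
      else Sup01 {min (Inf01 {Sup01 {H p q s |q. q \<in> F} |p. p \<in> E})
                      (Inf01 {Sup01 {H p q s |p. p \<in> E} |q. q \<in> F}) |s. s < t})"

definition Lambda_Hausdorff ::
    "'a set \<Rightarrow> ('a \<Rightarrow> 'a \<Rightarrow> ereal \<Rightarrow> real) \<Rightarrow> 'a set \<Rightarrow> ereal \<Rightarrow> real" where
  "Lambda_Hausdorff \<Omega> H E = prob_Hausdorff H (\<Omega> - E) \<Omega>"

definition tau_measurable_sets ::
    "'a set \<Rightarrow> 'a set set \<Rightarrow> ((ereal \<Rightarrow> real) \<Rightarrow> (ereal \<Rightarrow> real) \<Rightarrow> (ereal \<Rightarrow> real))
     \<Rightarrow> ('a set \<Rightarrow> ereal \<Rightarrow> real) \<Rightarrow> 'a set set" where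
  "tau_measurable_sets \<Omega> \<Sigma> \<tau> \<Lambda> =
     {E \<in> \<Sigma>. \<forall>G\<in>\<Sigma>. \<Lambda> G = \<tau> (\<Lambda> (G \<inter> E)) (\<Lambda> (G \<inter> (\<Omega> - E)))}"

definition tau_decomposable_measure ::
    "'a set \<Rightarrow> 'a set set \<Rightarrow> ((ereal \<Rightarrow> real) \<Rightarrow> (ereal \<Rightarrow> real) \<Rightarrow> (ereal \<Rightarrow> real))
     \<Rightarrow> ('a set \<Rightarrow> ereal \<Rightarrow> real) \<Rightarrow> bool" where
  "tau_decomposable_measure \<Omega> R \<tau> \<gamma> \<longleftrightarrow>
     ring_of_sets \<Omega> R \<and> \<gamma> \<in> R \<rightarrow> Delta_plus \<and> \<gamma> {} = eps0 \<and>
     (\<forall>E\<in>R. \<forall>F\<in>R. E \<inter> F = {} \<longrightarrow> \<gamma> (E \<union> F) = \<tau> (\<gamma> E) (\<gamma> F))"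

end

theory Submission
  imports Defs
begin

text \<open>Caratheodory's argument works with addition replaced by a triangle function: \<open>\<tau>\<close> is a
  commutative monoid operation on distance distribution functions, which is all that the argument
  for finite unions uses. It applies to any set function with values in \<open>\<Delta>\<^sup>+\<close> that sends the empty
  set to \<open>\<epsilon>\<^sub>0\<close>. The function \<open>\<Lambda>\<^sup>H\<close> sends the empty set to the distance of \<open>\<Omega>\<close> from itself, which is
  \<open>\<epsilon>\<^sub>0\<close> because each point of \<open>\<Omega>\<close> is its own best match.\<close>

section \<open>Suprema, infima and left regularization in the unit interval\<close>

lemma Sup01_mem:
  assumes "A \<subseteq> {0..1}"
  shows "Sup01 A \<in> {0..1}"
proof (cases "A = {}")
  case False
  then obtain a where "a \<in> A" by blast
  then have "a \<le> Sup A" "Sup A \<le> 1"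
    using assms False by (auto intro!: cSup_upper cSup_least bdd_aboveI[of _ 1])
  then show ?thesis using assms \<open>a \<in> A\<close> False by (force simp: Sup01_def)
qed (simp add: Sup01_def)

lemma Inf01_mem:
  assumes "A \<subseteq> {0..1}"
  shows "Inf01 A \<in> {0..1}"
proof (cases "A = {}")
  case False
  then obtain a where "a \<in> A" by blast
  then have "Inf A \<le> a" "0 \<le> Inf A"
    using assms False by (auto intro!: cInf_lower cInf_greatest bdd_belowI[of _ 0])
  then show ?thesis using assms \<open>a \<in> A\<close> False by (force simp: Inf01_def)
qed (simp add: Inf01_def)

text \<open>The function \<open>h\<close> is left arbitrary so that both halves of the Hausdorff
  distance are instances, the second with the two arguments exchanged.\<close>

lemma Inf01_Sup01_mem:
  assumes "\<And>p q. p \<in> E \<Longrightarrow> q \<in> F \<Longrightarrow> h p q \<in> {0..1}"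
  shows "Inf01 {Sup01 {h p q |q. q \<in> F} |p. p \<in> E} \<in> {0..1}"
proof (rule Inf01_mem, clarify)
  fix p assume "p \<in> E"
  then show "Sup01 {h p q |q. q \<in> F} \<in> {0..1}"
    using assms by (intro Sup01_mem) auto
qed

lemma Sup01_upper:
  assumes "A \<subseteq> {0..1}" "a \<in> A"
  shows "a \<le> Sup01 A"
  using assms by (auto simp: Sup01_def intro!: cSup_upper bdd_aboveI[of _ 1])

lemma Sup01_mono:
  assumes "B \<subseteq> {0..1}" and "\<And>a. a \<in> A \<Longrightarrow> \<exists>b\<in>B. a \<le> b"
  shows "Sup01 A \<le> Sup01 B"
proof (cases "A = {}")
  case True
  \<comment> \<open>The default value 0 of an empty supremum lies below every supremum in
    [0,1].\<close>
  then show ?thesis using Sup01_mem[OF assms(1)] by (simp add: Sup01_def)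
next
  case False
  have "Sup A \<le> Sup01 B"
    using assms(2) Sup01_upper[OF assms(1)] by (intro cSup_least[OF False]) force
  then show ?thesis using False by (simp add: Sup01_def)
qed

text \<open>Taking the supremum over all s < t makes an arbitrary [0,1]-valued \<open>g\<close>
  monotone, since the index set grows with t, and left-continuous, since a bound strictly below the
  supremum is already exceeded at some s < t. Both the Hausdorff distance and \<open>eps0\<close>
  have this shape.\<close>

lemma left_regularization_in_Delta_plus:
  fixes g :: "ereal \<Rightarrow> real"
  assumes g: "range g \<subseteq> {0..1}"
  shows "(\<lambda>t. if t \<le> 0 then 0 else if t = \<infinity> then 1 else Sup01 {g s |s. s < t}) \<in> Delta_plus"
    (is "?f \<in> _")
proof -
  have sub: "{g s |s. s < t} \<subseteq> {0..1}" for t using g by auto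
  have range: "?f t \<in> {0..1}" for t using Sup01_mem[OF sub] by simp
  have mono: "mono ?f"
  proof (rule monoI)
    fix s t :: ereal assume st: "s \<le> t"
    have "Sup01 {g u |u. u < s} \<le> Sup01 {g u |u. u < t}"
      using st by (intro Sup01_mono[OF sub]) (blast intro: less_le_trans)
    then show "?f s \<le> ?f t"
      using Sup01_mem[OF sub, of s] Sup01_mem[OF sub, of t] st by auto
  qed
  have "((\<lambda>y. ?f (ereal y)) \<longlongrightarrow> ?f (ereal x)) (at_left x)" for x :: real
  proof (rule order_tendstoI)
    fix a assume a: "a < ?f (ereal x)"
    show "\<forall>\<^sub>F y in at_left x. a < ?f (ereal y)"
    proof (cases "x \<le> 0")
      case True
      then have "a < ?f (ereal y)" if "y < x" for y
        using a that by simp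
      then show ?thesis
        unfolding eventually_at_filter by (intro always_eventually) blast
    next
      case False
      \<comment> \<open>The index set is never empty in the extended reals, so the default value of
        \<open>Sup01\<close> does not interfere.\<close>
      have "- \<infinity> < ereal x" by simp
      then have ne: "{g s |s. s < ereal x} \<noteq> {}" by blast
      then have "Sup01 {g s |s. s < ereal x} = Sup {g s |s. s < ereal x}"
        unfolding Sup01_def by (rule if_not_P)
      with a False have "a < Sup {g s |s. s < ereal x}" by simp
      from less_cSupD[OF ne this] obtain s where s: "s < ereal x" "a < g s"
        by blast
      \<comment> \<open>A real r above both 0 and s: for y > r the positive branch of the definition
        applies and \<open>g s\<close> is one of the values in the supremum.\<close>
      then have "max 0 s < ereal x" using False by simp
      then obtain r where r: "max 0 s < ereal r" "ereal r < ereal x"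
        using ereal_dense2 by blast
      have "a < ?f (ereal y)" if "r < y" for y
      proof -
        have "max 0 s < ereal y" using that by (intro less_trans[OF r(1)]) simp
        then have y: "0 < ereal y" "s < ereal y" by simp_all
        then have "g s \<le> Sup01 {g s |s. s < ereal y}" by (intro Sup01_upper[OF sub]) blast
        with s(2) y show ?thesis by auto
      qed
      then show ?thesis
        using r(2) unfolding eventually_at_left_field by (intro exI[of _ r]) simp
    qed
  next
    \<comment> \<open>From above, left-continuity is mere monotonicity.\<close>
    fix a assume a: "?f (ereal x) < a"
    have "?f (ereal y) < a" if "y < x" for y
      using monoD[OF mono, of "ereal y" "ereal x"] that
      by (intro le_less_trans[OF _ a]) simp
    then show "\<forall>\<^sub>F y in at_left x. ?f (ereal y) < a"
      unfolding eventually_at_filter by (intro always_eventually) blast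
  qed
  moreover have "range ?f \<subseteq> {0..1}" using range by blast
  ultimately show ?thesis
    unfolding Delta_plus_def continuous_within using mono by simp
qed

lemma min_mem_atLeastAtMost:
  fixes a b :: "'a::linorder"
  assumes "a \<in> {l..u}" "b \<in> {l..u}"
  shows "min a b \<in> {l..u}"
  using assms by (simp add: min_def)

lemma Delta_plus_mem: "F \<in> Delta_plus \<Longrightarrow> F t \<in> {0..1}"
  unfolding Delta_plus_def by blast

text \<open>The distance is the left regularization of the minimum of its two halves. Empty sets are
  covered, as they must be: the complement of \<Omega> occurs later.\<close>

lemma prob_Hausdorff_in_Delta_plus:
  assumes H: "\<And>p q. p \<in> E \<Longrightarrow> q \<in> F \<Longrightarrow> H p q \<in> Delta_plus"
  shows "prob_Hausdorff H E F \<in> Delta_plus"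
proof -
  have mem: "H p q s \<in> {0..1}" if "p \<in> E" "q \<in> F" for p q s
    using H[OF that] by (rule Delta_plus_mem)
  have "Inf01 {Sup01 {H p q s |q. q \<in> F} |p. p \<in> E} \<in> {0..1}"
    "Inf01 {Sup01 {H p q s |p. p \<in> E} |q. q \<in> F} \<in> {0..1}" for s
    using mem by (simp_all only: Inf01_Sup01_mem)
  then show ?thesis
    unfolding prob_Hausdorff_def[abs_def]
    by (intro left_regularization_in_Delta_plus)
      (auto intro!: min_mem_atLeastAtMost simp del: atLeastAtMost_iff)
qed

section \<open>Caratheodory's argument for a triangle function\<close>

context triangle_function
begin

lemma eps0_in_Delta_plus: "eps0 \<in> Delta_plus"
proof -
  \<comment> \<open>\<open>eps0\<close> is the left regularization of the constant 1.\<close>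
  have "(\<lambda>t::ereal. if t \<le> 0 then 0 else if t = \<infinity> then 1 else Sup01 {1 |s. s < t}) = eps0"
    by (auto simp: eps0_def Sup01_def fun_eq_iff not_le)
  with left_regularization_in_Delta_plus[of "\<lambda>_. 1"] show ?thesis by simp
qed

context
  fixes \<Omega> :: "'b set" and \<Lambda> :: "'b set \<Rightarrow> ereal \<Rightarrow> real"
  assumes in_Delta_plus: "\<Lambda> \<in> Pow \<Omega> \<rightarrow> Delta_plus" and empty: "\<Lambda> {} = eps0"
begin

lemma in_Delta_plus_if_subset: "G \<subseteq> \<Omega> \<Longrightarrow> \<Lambda> G \<in> Delta_plus"
  using in_Delta_plus by auto

lemma tau_measurable_empty: "{} \<in> tau_measurable_sets \<Omega> (Pow \<Omega>) \<tau> \<Lambda>"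
proof -
  \<comment> \<open>Here \<open>eps0\<close> is the left argument, while \<open>ident\<close> has it
    on the right; symmetry bridges this.\<close>
  have "\<Lambda> G = \<tau> (\<Lambda> (G \<inter> {})) (\<Lambda> (G \<inter> (\<Omega> - {})))" if "G \<subseteq> \<Omega>" for G
    using that in_Delta_plus_if_subset[OF that]
    by (simp add: Int_absorb2 empty ident sym[OF eps0_in_Delta_plus])
  then show ?thesis unfolding tau_measurable_sets_def by blast
qed

lemma tau_measurable_compl:
  assumes "E \<in> tau_measurable_sets \<Omega> (Pow \<Omega>) \<tau> \<Lambda>"
  shows "\<Omega> - E \<in> tau_measurable_sets \<Omega> (Pow \<Omega>) \<tau> \<Lambda>"
proof -
  have "\<Omega> - (\<Omega> - E) = E" using assms by (auto simp: tau_measurable_sets_def)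
  moreover have "\<tau> (\<Lambda> (G \<inter> E)) (\<Lambda> (G \<inter> (\<Omega> - E))) = \<tau> (\<Lambda> (G \<inter> (\<Omega> - E))) (\<Lambda> (G \<inter> E))"
    if "G \<subseteq> \<Omega>" for G
    using that by (intro sym in_Delta_plus_if_subset) auto
  ultimately show ?thesis using assms by (simp add: tau_measurable_sets_def)
qed

text \<open>Cut G by E, then cut the part outside E by F. This gives three pieces, and associativity
  regroups them so that the two inside the union stand together.\<close>

lemma tau_measurable_Un:
  assumes E: "E \<in> tau_measurable_sets \<Omega> (Pow \<Omega>) \<tau> \<Lambda>"
    and F: "F \<in> tau_measurable_sets \<Omega> (Pow \<Omega>) \<tau> \<Lambda>"
  shows "E \<union> F \<in> tau_measurable_sets \<Omega> (Pow \<Omega>) \<tau> \<Lambda>"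
proof -
  have sub: "E \<subseteq> \<Omega>" "F \<subseteq> \<Omega>"
    using E F by (auto simp: tau_measurable_sets_def)
  have split: "\<Lambda> G = \<tau> (\<Lambda> (G \<inter> D)) (\<Lambda> (G \<inter> (\<Omega> - D)))"
    if "D \<in> tau_measurable_sets \<Omega> (Pow \<Omega>) \<tau> \<Lambda>" "G \<subseteq> \<Omega>" for D G
    using that by (auto simp: tau_measurable_sets_def)
  have "\<Lambda> G = \<tau> (\<Lambda> (G \<inter> (E \<union> F))) (\<Lambda> (G \<inter> (\<Omega> - (E \<union> F))))" if G: "G \<subseteq> \<Omega>" for G
  proof -
    let ?A = "G \<inter> E" and ?B = "G \<inter> (\<Omega> - E) \<inter> F" and ?C = "G \<inter> (\<Omega> - (E \<union> F))"
    have sets: "G \<inter> (\<Omega> - E) \<inter> (\<Omega> - F) = ?C" "G \<inter> (E \<union> F) \<inter> E = ?A"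
      "G \<inter> (E \<union> F) \<inter> (\<Omega> - E) = ?B"
      using G by auto
    have "\<Lambda> G = \<tau> (\<Lambda> ?A) (\<Lambda> (G \<inter> (\<Omega> - E)))"
      using split[OF E G] .
    also have "\<Lambda> (G \<inter> (\<Omega> - E)) = \<tau> (\<Lambda> ?B) (\<Lambda> ?C)"
      using split[OF F, of "G \<inter> (\<Omega> - E)"] G unfolding sets by (simp add: le_infI1)
    also have "\<tau> (\<Lambda> ?A) (\<tau> (\<Lambda> ?B) (\<Lambda> ?C)) = \<tau> (\<tau> (\<Lambda> ?A) (\<Lambda> ?B)) (\<Lambda> ?C)"
      using G by (intro assoc[symmetric] in_Delta_plus_if_subset) auto
    \<comment> \<open>E is tested a second time, on the part of G inside the union, which it cuts
      into exactly \<open>?A\<close> and \<open>?B\<close>.\<close>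
    also have "\<tau> (\<Lambda> ?A) (\<Lambda> ?B) = \<Lambda> (G \<inter> (E \<union> F))"
      using split[OF E, of "G \<inter> (E \<union> F)"] G unfolding sets by (simp add: le_infI1)
    finally show ?thesis .
  qed
  then show ?thesis using sub unfolding tau_measurable_sets_def by blast
qed

lemma algebra_tau_measurable_sets: "algebra \<Omega> (tau_measurable_sets \<Omega> (Pow \<Omega>) \<tau> \<Lambda>)"
proof -
  have "tau_measurable_sets \<Omega> (Pow \<Omega>) \<tau> \<Lambda> \<subseteq> Pow \<Omega>"
    unfolding tau_measurable_sets_def by blast
  then show ?thesis
    unfolding algebra_iff_Un
    using tau_measurable_empty tau_measurable_compl tau_measurable_Un by blast
qed

text \<open>The union itself serves as the test set: by disjointness, E cuts it into E and
  F.\<close>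

lemma tau_measurable_disjoint_Un:
  assumes "E \<in> tau_measurable_sets \<Omega> (Pow \<Omega>) \<tau> \<Lambda>" "F \<subseteq> \<Omega>" "E \<inter> F = {}"
  shows "\<Lambda> (E \<union> F) = \<tau> (\<Lambda> E) (\<Lambda> F)"
proof -
  have "(E \<union> F) \<inter> E = E" "(E \<union> F) \<inter> (\<Omega> - E) = F" "E \<union> F \<in> Pow \<Omega>"
    using assms by (auto simp: tau_measurable_sets_def)
  moreover have "\<forall>G\<in>Pow \<Omega>. \<Lambda> G = \<tau> (\<Lambda> (G \<inter> E)) (\<Lambda> (G \<inter> (\<Omega> - E)))"
    using assms(1) unfolding tau_measurable_sets_def by blast
  ultimately show ?thesis by metis
qed

lemma tau_decomposable_measure_restrict:
  defines "S \<equiv> tau_measurable_sets \<Omega> (Pow \<Omega>) \<tau> \<Lambda>"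
  shows "tau_decomposable_measure \<Omega> S \<tau> (restrict \<Lambda> S)"
proof -
  \<comment> \<open>Closure of \<open>S\<close> keeps the empty set and unions where
    \<open>restrict\<close> agrees with \<Lambda>.\<close>
  interpret algebra \<Omega> S
    unfolding S_def by (rule algebra_tau_measurable_sets)
  have "\<Lambda> (E \<union> F) = \<tau> (\<Lambda> E) (\<Lambda> F)" if "E \<in> S" "F \<in> S" "E \<inter> F = {}" for E F
    using that sets_into_space tau_measurable_disjoint_Un unfolding S_def by blast
  moreover have "\<Lambda> E \<in> Delta_plus" if "E \<in> S" for E
    using that sets_into_space by (intro in_Delta_plus_if_subset) blast
  ultimately show ?thesis
    using ring_of_sets_axioms
    by (auto simp: tau_decomposable_measure_def empty)
qed

end

end

section \<open>The distance of the whole space from itself\<close>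

lemma (in PM_space) prob_Hausdorff_self: "prob_Hausdorff H \<Omega> \<Omega> = eps0"
proof
  fix t :: ereal
  show "prob_Hausdorff H \<Omega> \<Omega> t = eps0 t"
  proof (cases "t \<le> 0 \<or> t = \<infinity>")
    case True
    then show ?thesis by (auto simp: prob_Hausdorff_def eps0_def)
  next
    case False
    define g where "g s = min (Inf01 {Sup01 {H p q s |q. q \<in> \<Omega>} |p. p \<in> \<Omega>})
      (Inf01 {Sup01 {H p q s |p. p \<in> \<Omega>} |q. q \<in> \<Omega>})" for s
    have mem: "H p q s \<in> {0..1}" if "p \<in> \<Omega>" "q \<in> \<Omega>" for p q s
      using in_Delta_plus[OF that] by (rule Delta_plus_mem)
    have "Inf01 {Sup01 {H p q s |q. q \<in> \<Omega>} |p. p \<in> \<Omega>} \<in> {0..1}"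
      "Inf01 {Sup01 {H p q s |p. p \<in> \<Omega>} |q. q \<in> \<Omega>} \<in> {0..1}" for s
      using mem by (simp_all only: Inf01_Sup01_mem)
    then have g_mem: "range g \<subseteq> {0..1}"
      by (auto simp: g_def intro!: min_mem_atLeastAtMost simp del: atLeastAtMost_iff)
    \<comment> \<open>One positive s below t suffices: there \<open>H p p s\<close> is 1, so both
      halves of the minimum equal 1, the largest possible value.\<close>
    from False obtain s where s: "0 < s" "s < t"
      using dense[of 0 t] by (auto simp: not_le)
    have H1: "H p p s = 1" if "p \<in> \<Omega>" for p
      using eq_eps0_iff[OF that that] s by (simp add: eps0_def)
    have eq_1: "Sup01 A = 1" if "1 \<in> A" "A \<subseteq> {0..1}" for A
      using Sup01_upper[OF that(2,1)] Sup01_mem[OF that(2)] by simp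
    have sup_1: "Sup01 {H p q s |q. q \<in> \<Omega>} = 1" "Sup01 {H q p s |q. q \<in> \<Omega>} = 1" if "p \<in> \<Omega>" for p
      using that mem H1[OF that, symmetric] by (blast intro!: eq_1)+
    \<comment> \<open>Since \<Omega> has a point, the value set is a genuine singleton and its
      infimum can be read off.\<close>
    have image_1: "{h p |p. p \<in> \<Omega>} = {1}" if "\<And>p. p \<in> \<Omega> \<Longrightarrow> h p = 1" for h :: "'a \<Rightarrow> real"
      using that nonempty by force
    have "{Sup01 {H p q s |q. q \<in> \<Omega>} |p. p \<in> \<Omega>} = {1}"
      by (rule image_1) (rule sup_1(1))
    moreover have "{Sup01 {H p q s |p. p \<in> \<Omega>} |q. q \<in> \<Omega>} = {1}"
      by (rule image_1) (rule sup_1(2))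
    ultimately have g_1: "1 = g s" unfolding g_def by (simp only: Inf01_def) simp
    have "Sup01 {g s |s. s < t} = 1"
      using s(2) g_1 g_mem by (intro eq_1) blast+
    then show ?thesis using False by (simp add: prob_Hausdorff_def g_def eps0_def not_le)
  qed
qed

theorem theorem5p6:
  fixes \<Omega> :: "'a set" and H :: "'a \<Rightarrow> 'a \<Rightarrow> ereal \<Rightarrow> real"
    and \<tau> :: "(ereal \<Rightarrow> real) \<Rightarrow> (ereal \<Rightarrow> real) \<Rightarrow> (ereal \<Rightarrow> real)"
  assumes "PM_space \<tau> \<Omega> H"
  defines "S \<equiv> tau_measurable_sets \<Omega> (Pow \<Omega>) \<tau> (Lambda_Hausdorff \<Omega> H)"
  shows "Lambda_Hausdorff \<Omega> H \<in> Pow \<Omega> \<rightarrow> Delta_plus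
    \<and> algebra \<Omega> S
    \<and> tau_decomposable_measure \<Omega> S \<tau> (restrict (Lambda_Hausdorff \<Omega> H) S)"
proof -
  interpret PM_space \<tau> \<Omega> H by fact
  have Lambda: "Lambda_Hausdorff \<Omega> H \<in> Pow \<Omega> \<rightarrow> Delta_plus"
    unfolding Lambda_Hausdorff_def
    by (auto intro!: prob_Hausdorff_in_Delta_plus in_Delta_plus)
  have empty: "Lambda_Hausdorff \<Omega> H {} = eps0"
    by (simp add: Lambda_Hausdorff_def prob_Hausdorff_self)
  show ?thesis
    unfolding S_def
    using Lambda algebra_tau_measurable_sets[OF Lambda empty]
      tau_decomposable_measure_restrict[OF Lambda empty] by blast
qed

end
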